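(* Let $X=(x_0,x_1)$ be a bounded interval and $\zeta\in C^1_+(X)$. Let $\zeta_n$ $(n\ge1)$ be the standard approximation to $\zeta$, and set $\alpha=-\zeta'/(2\zeta)$. For every $y\in(x_0,x_1]$, $$\mathcal{E}_{\zeta_n}^{(x_0,y)}\to E_\alpha^{(x_0,y)}\quad\text{as }n\to\infty$$ uniformly on compact subsets of $\mathbb{R}$.
   Context: A function on $X$ is regulated if it is a uniform limit of step functions (piecewise-constant with finitely many discontinuities). $C^1_+(X)$ is the set of positive, regulated, continuously differentiable functions on $X$ that are bounded away from $0$ and whose derivative is also regulated (so $\alpha$ is bounded). $\mathrm{Step}_+(X)$ is the set of strictly positive step functions. One-sided limits are written $f(x\pm)$. Standard approximation: with $\Delta_n=(x_1-x_0)/(n+1)$ and $y_{n,j}=x_0+j\Delta_n$ $(0\le j\le n+1)$, $\zeta_n\in\mathrm{Step}_+(X)$ is given by $\zeta_n(x)=\zeta(y_{n,j}+\Delta_n/2)$ if $y_{n,j}\le x<y_{n,j+1}$ $(0\le j\le n)$. Singular harmonic exponential: for $\eta\in\mathrm{Step}_+(X)$ let $r(x)=\frac{\eta(x-)-\eta(x+)}{\eta(x-)+\eta(x+)}$ $(x\in X)$, which is nonzero only at the finitely many jump points of $\eta$. For $\omega\in\mathbb{R}$ and $f$ a step function put $\mathcal{Z}_\omega f(y)=\sum_{x_0<x<y}r(x)e^{2i(x-x_0)\omega}\overline{f(x)}$. Then $\mathcal{E}^{(x_0,y)}_\eta(\omega)=(1-\mathcal{Z}_\omega)^{-1}\mathbb{1}(y)$,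 where $\mathbb{1}$ is the constant function $1$; explicitly, it is the finite sum $$\mathcal{E}^{(x_0,y)}_\eta(\omega)=1+\sum_{k\ge1}\ \sum_{x_0<s_1<\cdots<s_k<y}\exp\Bigl(2i\omega\sum_{\nu=1}^k(-1)^{k-\nu}(s_\nu-x_0)\Bigr)\prod_{\nu=1}^kr(s_\nu),$$ with $s_1,\dots,s_k$ ranging over jump points of $\eta$. Regular harmonic exponential: for real-valued $\alpha\in L^1(X)$ and $\omega\in\mathbb{R}$, $$E^{(x_0,y)}_\alpha(\omega)=1+\sum_{j=1}^\infty\ \int\limits_{x_0<s_1<\cdots<s_j<y}\exp\Bigl(2i\omega\sum_{\nu=1}^j(-1)^{j-\nu}(s_\nu-x_0)\Bigr)\prod_{\nu=1}^j\alpha(s_\nu)\,ds_1\cdots ds_j .$$ *)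

theory Defs
  imports "HOL-Analysis.Analysis"
begin

definition step_on :: "real set \<Rightarrow> (real \<Rightarrow> real) \<Rightarrow> bool" where
  "step_on X f \<longleftrightarrow> (\<exists>D. finite D \<and> (\<forall>C \<in> components (X - D). f constant_on C))"

definition regulated_on :: "real set \<Rightarrow> (real \<Rightarrow> real) \<Rightarrow> bool" where
  "regulated_on X f \<longleftrightarrow>
     (\<exists>s. (\<forall>n::nat. step_on X (s n)) \<and> uniform_limit X s f sequentially)"

definition C1_plus :: "real set \<Rightarrow> (real \<Rightarrow> real) set" where
  "C1_plus X = {f. (\<forall>x\<in>X. f x > 0) \<and> regulated_on X f \<and> f C1_differentiable_on X \<and>
                   (\<exists>c>0. \<forall>x\<in>X. c \<le> f x) \<and> regulated_on X (deriv f)}"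

definition mesh :: "real \<Rightarrow> real \<Rightarrow> nat \<Rightarrow> real" where
  "mesh x0 x1 n = (x1 - x0) / (real n + 1)"

definition node :: "real \<Rightarrow> real \<Rightarrow> nat \<Rightarrow> nat \<Rightarrow> real" where
  "node x0 x1 n j = x0 + real j * mesh x0 x1 n"

text \<open>The half-open cells are disjoint and cover the interval, so on it exactly one summand is
  active; outside the value is \<open>0\<close>, which nothing below uses.\<close>

definition std_approx :: "real \<Rightarrow> real \<Rightarrow> (real \<Rightarrow> real) \<Rightarrow> nat \<Rightarrow> real \<Rightarrow> real" where
  "std_approx x0 x1 \<zeta> n x =
     (\<Sum>j\<le>n. if node x0 x1 n j \<le> x \<and> x < node x0 x1 n (j + 1)
            then \<zeta> (node x0 x1 n j + mesh x0 x1 n / 2) else 0)"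

definition refl_coeff :: "(real \<Rightarrow> real) \<Rightarrow> real \<Rightarrow> real" where
  "refl_coeff \<eta> x =
     (Lim (at_left x) \<eta> - Lim (at_right x) \<eta>) / (Lim (at_left x) \<eta> + Lim (at_right x) \<eta>)"

definition jumps :: "real \<Rightarrow> real \<Rightarrow> (real \<Rightarrow> real) \<Rightarrow> real set" where
  "jumps x0 x1 \<eta> = {x \<in> {x0<..<x1}. refl_coeff \<eta> x \<noteq> 0}"

definition Z_op ::
  "real \<Rightarrow> real \<Rightarrow> (real \<Rightarrow> real) \<Rightarrow> real \<Rightarrow> (real \<Rightarrow> complex) \<Rightarrow> real \<Rightarrow> complex" where
  "Z_op x0 x1 \<eta> \<omega> f y =
     (\<Sum>x \<in> {x \<in> jumps x0 x1 \<eta>. x < y}.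
        of_real (refl_coeff \<eta> x) * exp (2 * \<i> * of_real (x - x0) * of_real \<omega>) * cnj (f x))"

text \<open>Here \<open>Z_op\<close> acts on all complex-valued functions on the line. As shown below,
  \<open>1 - Z_op\<close> is bijective there when there are finitely many jumps, in particular for step
  functions \<open>\<eta>\<close>. Since \<open>Z_op\<close> only produces step functions, the preimage of the constant
  \<open>1\<close> is itself a step function, so this is also the inverse on step functions.\<close>

definition sing_harm_exp ::
  "real \<Rightarrow> real \<Rightarrow> (real \<Rightarrow> real) \<Rightarrow> real \<Rightarrow> real \<Rightarrow> complex" where
  "sing_harm_exp x0 x1 \<eta> y \<omega> = inv (\<lambda>f z. f z - Z_op x0 x1 \<eta> \<omega> f z) (\<lambda>_. 1) y"

definition ordered_simplex :: "real \<Rightarrow> real \<Rightarrow> nat \<Rightarrow> (nat \<Rightarrow> real) set" where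
  "ordered_simplex x0 y j =
     {s. (\<forall>\<nu>\<in>{1..j}. x0 < s \<nu> \<and> s \<nu> < y) \<and> strict_mono_on {1..j} s}"

definition reg_harm_term ::
  "real \<Rightarrow> (real \<Rightarrow> real) \<Rightarrow> real \<Rightarrow> real \<Rightarrow> nat \<Rightarrow> complex" where
  "reg_harm_term x0 \<alpha> y \<omega> j =
     (LINT s : ordered_simplex x0 y j | Pi\<^sub>M {1..j} (\<lambda>_. lborel).
        exp (2 * \<i> * of_real \<omega> * of_real (\<Sum>\<nu>=1..j. (-1) ^ (j - \<nu>) * (s \<nu> - x0)))
        * of_real (\<Prod>\<nu>=1..j. \<alpha> (s \<nu>)))"

definition reg_harm_exp ::
  "real \<Rightarrow> (real \<Rightarrow> real) \<Rightarrow> real \<Rightarrow> real \<Rightarrow> complex" where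
  "reg_harm_exp x0 \<alpha> y \<omega> = 1 + (\<Sum>j. reg_harm_term x0 \<alpha> y \<omega> (Suc j))"

lemma finite_jumps:
  assumes "step_on {x0<..<x1} \<eta>"
  shows "finite (jumps x0 x1 \<eta>)"
proof -
  obtain D where D: "finite D" "\<And>C. C \<in> components ({x0<..<x1} - D) \<Longrightarrow> \<eta> constant_on C"
    using assms unfolding step_on_def by blast
  have "refl_coeff \<eta> x = 0" if x: "x \<in> {x0<..<x1} - D" for x
  proof -
    have "open ({x0<..<x1} - D)"
      using D(1) by (intro open_Diff finite_imp_closed) auto
    then obtain e where e: "e > 0" "ball x e \<subseteq> {x0<..<x1} - D"
      using x open_contains_ball by blast
    define C where "C = connected_component_set ({x0<..<x1} - D) x"
    have "C \<in> components ({x0<..<x1} - D)"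
      using x unfolding C_def by (auto simp: components_def)
    then obtain c where c: "\<And>z. z \<in> C \<Longrightarrow> \<eta> z = c"
      using D(2) unfolding constant_on_def by blast
    have "ball x e \<subseteq> C"
      unfolding C_def using e by (intro connected_component_maximal) auto
    then have ev: "\<forall>\<^sub>F z in at x. \<eta> z = c"
      unfolding eventually_at
    proof (intro exI[of _ e] conjI ballI impI)
      fix z assume "z \<noteq> x \<and> dist z x < e"
      then have "z \<in> ball x e" by (simp add: dist_commute)
      then show "\<eta> z = c" using c \<open>ball x e \<subseteq> C\<close> by blast
    qed (use e in auto)
    have "(\<eta> \<longlongrightarrow> c) (at x)"
      using ev by (rule tendsto_eventually)
    then have "(\<eta> \<longlongrightarrow> c) (at_left x)" "(\<eta> \<longlongrightarrow> c) (at_right x)"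
      by (auto intro: tendsto_within_subset)
    then have "Lim (at_left x) \<eta> = c" "Lim (at_right x) \<eta> = c"
      by (auto intro!: tendsto_Lim)
    then show ?thesis by (simp add: refl_coeff_def)
  qed
  then have "jumps x0 x1 \<eta> \<subseteq> D" by (auto simp: jumps_def)
  then show ?thesis using D(1) finite_subset by blast
qed

lemma triangular_bij:
  fixes c :: "real \<Rightarrow> complex"
  assumes "finite J"
  shows "bij (\<lambda>f z. f z - (\<Sum>x \<in> {x \<in> J. x < z}. c x * cnj (f x)))"
proof (rule bijI)
  show "inj (\<lambda>f z. f z - (\<Sum>x \<in> {x \<in> J. x < z}. c x * cnj (f x)))"
  proof (rule injI)
    fix f g :: "real \<Rightarrow> complex"
    assume "(\<lambda>z. f z - (\<Sum>x \<in> {x \<in> J. x < z}. c x * cnj (f x))) =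
            (\<lambda>z. g z - (\<Sum>x \<in> {x \<in> J. x < z}. c x * cnj (g x)))"
    then have eq: "f z - (\<Sum>x \<in> {x \<in> J. x < z}. c x * cnj (f x)) =
                   g z - (\<Sum>x \<in> {x \<in> J. x < z}. c x * cnj (g x))" for z
      by meson
    have step: "f z = g z" if "\<forall>x\<in>J. x < z \<longrightarrow> f x = g x" for z
    proof -
      have "(\<Sum>x \<in> {x \<in> J. x < z}. c x * cnj (f x)) = (\<Sum>x \<in> {x \<in> J. x < z}. c x * cnj (g x))"
        using that by (intro sum.cong) auto
      then show ?thesis using eq[of z] by simp
    qed
    have onJ: "\<forall>x\<in>J. f x = g x"
    proof (rule ccontr)
      define B where "B = {x \<in> J. f x \<noteq> g x}"
      assume "\<not> ?thesis"
      then have B: "finite B" "B \<noteq> {}" using assms by (auto simp: B_def)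
      have "\<forall>x\<in>J. x < Min B \<longrightarrow> f x = g x"
        using Min_le[OF B(1)] by (force simp: B_def)
      then have "f (Min B) = g (Min B)" by (rule step)
      then show False using Min_in[OF B] by (simp add: B_def)
    qed
    then show "f = g" using step by blast
  qed
next
  have "\<exists>f. \<forall>z. f z - (\<Sum>x \<in> {x \<in> J. x < z}. c x * cnj (f x)) = g z" for g
    using assms
  proof (induction J rule: finite_linorder_max_induct)
    case empty
    then show ?case by auto
  next
    case (insert b A)
    then obtain f where f: "\<And>z. f z - (\<Sum>x \<in> {x \<in> A. x < z}. c x * cnj (f x)) = g z"
      by blast
    define h where "h z = f z + (if b < z then c b * cnj (f b) else 0)" for z
    have hA: "h x = f x" if "x \<in> insert b A" for x
      using that insert.hyps by (auto simp: h_def)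
    have "h z - (\<Sum>x \<in> {x \<in> insert b A. x < z}. c x * cnj (h x)) = g z" for z
    proof -
      have "(\<Sum>x \<in> {x \<in> insert b A. x < z}. c x * cnj (h x)) =
            (\<Sum>x \<in> {x \<in> insert b A. x < z}. c x * cnj (f x))"
        using hA by (intro sum.cong) auto
      also have "\<dots> = (\<Sum>x \<in> {x \<in> A. x < z}. c x * cnj (f x)) +
                       (if b < z then c b * cnj (f b) else 0)"
      proof (cases "b < z")
        case True
        then have "{x \<in> insert b A. x < z} = insert b {x \<in> A. x < z}" by auto
        moreover have "b \<notin> A" using insert.hyps by auto
        ultimately show ?thesis using True insert.hyps by (simp add: add.commute)
      next
        case False
        then have "{x \<in> insert b A. x < z} = {x \<in> A. x < z}" by auto
        then show ?thesis using False by simp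
      qed
      finally show ?thesis using f[of z] by (simp add: h_def)
    qed
    then show ?case by blast
  qed
  then show "surj (\<lambda>f z. f z - (\<Sum>x \<in> {x \<in> J. x < z}. c x * cnj (f x)))"
    unfolding surj_def by (metis (no_types, lifting) ext)
qed

lemma bij_one_minus_Z_op:
  assumes "step_on {x0<..<x1} \<eta>"
  shows "bij (\<lambda>f z. f z - Z_op x0 x1 \<eta> \<omega> f z)"
  unfolding Z_op_def using triangular_bij[OF finite_jumps[OF assms]] .

end

theory Submission
  imports Defs
begin

text \<open>Fubini on the top variable of the simplex turns the series of the regular exponential \<open>E\<close> into
  the Volterra equation
  \<open>E z = 1 + (integral from x0 to z of \<alpha> s * exp (2 * \<i> * \<omega> * (s - x0)) * cnj (E s))\<close>. The
  singular exponential \<open>F\<close> of \<open>\<zeta>\<^sub>n\<close> satisfies the same equation with a sum over the grid points, the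
  weight \<open>\<alpha> s ds\<close> being replaced by the reflection coefficients. For neighbouring cell midpoints
  \<open>a < b\<close> that coefficient is \<open>(\<zeta> a - \<zeta> b) / (\<zeta> a + \<zeta> b)\<close>, which is the integral of
  \<open>- deriv \<zeta> / (\<zeta> a + \<zeta> b)\<close> over the cell between them; since \<open>\<zeta>\<close> and \<open>E\<close> are Lipschitz, one cell
  contributes an error quadratic in the mesh, so \<open>E\<close> solves the discrete equation up to an error
  linear in the mesh. The discrete Gronwall inequality bounds \<open>F - E\<close> by a multiple of the mesh that
  depends on \<open>\<omega>\<close> only through a bound for \<open>\<bar>\<omega>\<bar>\<close>.\<close>

subsection \<open>Regulated functions and the discrete Gronwall inequality\<close>

text \<open>Away from \<open>D\<close>, the value at a point depends only on which elements of
  \<open>D\<close> lie to its left: two points with the same set have no element of \<open>D\<close>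
  between them and so share a component. A finite \<open>D\<close> has finitely many subsets, and
  \<open>D\<close> itself adds finitely many values.\<close>

lemma step_on_finite_image:
  assumes "step_on {a<..<b} f"
  shows "finite (f ` {a<..<b})"
proof -
  obtain D where D: "finite D" "\<And>C. C \<in> components ({a<..<b} - D) \<Longrightarrow> f constant_on C"
    using assms unfolding step_on_def by blast
  define below where "below x = {d \<in> D. d < x}" for x
  have eq: "f x = f x'" if "x \<in> {a<..<b} - D" "x' \<in> {a<..<b} - D" "below x = below x'" "x \<le> x'" for x x'
  proof -
    have "{x..x'} \<subseteq> {a<..<b} - D"
    proof
      fix t assume t: "t \<in> {x..x'}"
      have "t \<notin> D"
      proof
        assume "t \<in> D"
        then have "t < x'" using t that by (cases "t = x'") auto
        then have "t \<in> below x'" using \<open>t \<in> D\<close> by (simp add: below_def)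
        then have "t \<in> below x" using that(3) by simp
        then show False using t by (simp add: below_def)
      qed
      then show "t \<in> {a<..<b} - D" using t that by auto
    qed
    then have "{x..x'} \<subseteq> connected_component_set ({a<..<b} - D) x"
      using that by (intro connected_component_maximal) auto
    moreover have "f constant_on connected_component_set ({a<..<b} - D) x"
      using that by (intro D(2)) (auto simp: components_def)
    ultimately show ?thesis
      using that unfolding constant_on_def by (metis atLeastAtMost_iff order_refl subsetD)
  qed
  have sym: "f x = f x'" if "x \<in> {a<..<b} - D" "x' \<in> {a<..<b} - D" "below x = below x'" for x x'
  proof (cases "x \<le> x'")
    case True
    then show ?thesis by (rule eq[OF that])
  next
    case False
    then show ?thesis using eq[OF that(2,1) that(3)[symmetric]] by simp
  qed
  have "finite (below ` ({a<..<b} - D))"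
    by (rule finite_subset[of _ "Pow D"]) (use D(1) in \<open>auto simp: below_def\<close>)
  moreover have "f ` ({a<..<b} - D) \<subseteq>
      (\<lambda>B. f (SOME x. x \<in> {a<..<b} - D \<and> below x = B)) ` below ` ({a<..<b} - D)"
  proof
    fix v assume "v \<in> f ` ({a<..<b} - D)"
    then obtain x where x: "x \<in> {a<..<b} - D" "v = f x" by blast
    let ?x = "SOME x'. x' \<in> {a<..<b} - D \<and> below x' = below x"
    have "?x \<in> {a<..<b} - D \<and> below ?x = below x"
      by (rule someI[of _ x]) (use x in auto)
    then have "v = f ?x" using sym[of x ?x] x by simp
    then show "v \<in> (\<lambda>B. f (SOME x. x \<in> {a<..<b} - D \<and> below x = B)) ` below ` ({a<..<b} - D)"
      using x(1) by blast
  qed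
  ultimately have "finite (f ` ({a<..<b} - D))"
    using finite_surj by blast
  moreover have "f ` {a<..<b} \<subseteq> f ` ({a<..<b} - D) \<union> f ` D" by auto
  ultimately show ?thesis
    using D(1) by (meson finite_Un finite_imageI finite_subset)
qed

text \<open>Step functions have finite range, and a uniform limit of bounded functions is bounded.
  Applied to \<open>deriv \<zeta>\<close>, this supplies the Lipschitz constant of
  \<open>\<zeta>\<close>.\<close>

lemma regulated_on_bounded:
  assumes "regulated_on {a<..<b} f"
  shows "bounded (f ` {a<..<b})"
proof -
  obtain s where s: "\<And>n::nat. step_on {a<..<b} (s n)" "uniform_limit {a<..<b} s f sequentially"
    using assms unfolding regulated_on_def by blast
  show ?thesis
    by (rule uniform_limit_bounded[OF s(2)])
       (use s(1) in \<open>auto intro!: always_eventually finite_imp_bounded step_on_finite_image\<close>)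
qed

text \<open>The geometric majorant solves the recursion with equality (\<open>geom\<close>), so
  strong induction compares the two sums term by term.\<close>

lemma discrete_gronwall:
  fixes d :: "nat \<Rightarrow> real"
  assumes "\<rho> \<ge> 0" and step: "\<And>k. k \<le> n \<Longrightarrow> d k \<le> \<epsilon> + (\<Sum>j<k. \<rho> * d j)"
  shows "k \<le> n \<Longrightarrow> d k \<le> \<epsilon> * (1 + \<rho>) ^ k"
proof (induction k rule: less_induct)
  case (less k)
  have geom: "\<epsilon> + (\<Sum>j<m. \<rho> * (\<epsilon> * (1 + \<rho>) ^ j)) = \<epsilon> * (1 + \<rho>) ^ m" for m
    by (induction m) (auto simp: algebra_simps)
  have "(\<Sum>j<k. \<rho> * d j) \<le> (\<Sum>j<k. \<rho> * (\<epsilon> * (1 + \<rho>) ^ j))"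
    using less assms(1) by (intro sum_mono mult_left_mono) auto
  then show ?case
    using step[OF less.prems] geom[of k] by linarith
qed

subsection \<open>The standard approximation\<close>

lemma mesh_pos: "x0 < x1 \<Longrightarrow> mesh x0 x1 n > 0"
  by (simp add: mesh_def)

lemma Suc_mult_mesh: "real (Suc n) * mesh x0 x1 n = x1 - x0"
  by (simp add: mesh_def add.commute)

lemma node_0 [simp]: "node x0 x1 n 0 = x0"
  by (simp add: node_def)

lemma node_Suc: "node x0 x1 n (Suc j) = node x0 x1 n j + mesh x0 x1 n"
  by (simp add: node_def algebra_simps)

lemma node_last: "node x0 x1 n (Suc n) = x1"
  by (simp add: node_def mesh_def field_simps)

lemma node_less_iff: "x0 < x1 \<Longrightarrow> node x0 x1 n i < node x0 x1 n j \<longleftrightarrow> i < j"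
  by (simp add: node_def mesh_pos)

lemma node_le_iff: "x0 < x1 \<Longrightarrow> node x0 x1 n i \<le> node x0 x1 n j \<longleftrightarrow> i \<le> j"
  by (simp add: node_def mesh_pos)

lemma std_approx_cell:
  assumes "x0 < x1" "k \<le> n" "node x0 x1 n k \<le> x" "x < node x0 x1 n (Suc k)"
  shows "std_approx x0 x1 \<zeta> n x = \<zeta> (node x0 x1 n k + mesh x0 x1 n / 2)"
proof -
  have "(node x0 x1 n j \<le> x \<and> x < node x0 x1 n (j + 1)) \<longleftrightarrow> j = k" for j
  proof
    assume "node x0 x1 n j \<le> x \<and> x < node x0 x1 n (j + 1)"
    then have "node x0 x1 n j < node x0 x1 n (Suc k)" "node x0 x1 n k < node x0 x1 n (Suc j)"
      using assms by auto
    then show "j = k" using assms(1) by (simp add: node_less_iff)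
  qed (use assms in auto)
  then show ?thesis
    using assms(2) by (simp add: std_approx_def)
qed

text \<open>Cells are open on the left and closed on the right here, unlike in
  \<open>std_approx\<close>: the sum in \<open>Z_op\<close> runs over jumps strictly below
  \<open>z\<close>, so at a node the jump located there is not counted yet.\<close>

lemma obtain_cell:
  assumes "x0 < x1" "x0 < z" "z \<le> x1"
  obtains k where "k \<le> n" "node x0 x1 n k < z" "z \<le> node x0 x1 n (Suc k)"
proof -
  define m where "m = (LEAST j. z \<le> node x0 x1 n j)"
  have ex: "z \<le> node x0 x1 n (Suc n)" using assms by (simp add: node_last)
  then have m: "z \<le> node x0 x1 n m" "m \<le> Suc n"
    unfolding m_def by (auto intro: LeastI Least_le)
  then obtain k where k: "m = Suc k"
    using assms by (cases m) auto
  have "node x0 x1 n k < z"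
    using not_less_Least[of k "\<lambda>j. z \<le> node x0 x1 n j"] k unfolding m_def by auto
  then show ?thesis using that m k by auto
qed

lemma refl_coeff_eqI:
  assumes "(\<eta> \<longlongrightarrow> l) (at_left x)" "(\<eta> \<longlongrightarrow> r) (at_right x)"
  shows "refl_coeff \<eta> x = (l - r) / (l + r)"
  using assms by (simp add: refl_coeff_def tendsto_Lim)

text \<open>The left limit may be taken at the right end of a cell, and in the next lemma the right
  limit at the left end, so at a node the two describe adjacent cells.\<close>

lemma std_approx_at_left:
  assumes "x0 < x1" "k \<le> n" "node x0 x1 n k < x" "x \<le> node x0 x1 n (Suc k)"
  shows "(std_approx x0 x1 \<zeta> n \<longlongrightarrow> \<zeta> (node x0 x1 n k + mesh x0 x1 n / 2)) (at_left x)"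
proof (rule tendsto_eventually)
  show "\<forall>\<^sub>F t in at_left x. std_approx x0 x1 \<zeta> n t = \<zeta> (node x0 x1 n k + mesh x0 x1 n / 2)"
    unfolding eventually_at_left_field
    by (intro exI[of _ "node x0 x1 n k"]) (use assms in \<open>auto intro!: std_approx_cell\<close>)
qed

lemma std_approx_at_right:
  assumes "x0 < x1" "k \<le> n" "node x0 x1 n k \<le> x" "x < node x0 x1 n (Suc k)"
  shows "(std_approx x0 x1 \<zeta> n \<longlongrightarrow> \<zeta> (node x0 x1 n k + mesh x0 x1 n / 2)) (at_right x)"
proof (rule tendsto_eventually)
  show "\<forall>\<^sub>F t in at_right x. std_approx x0 x1 \<zeta> n t = \<zeta> (node x0 x1 n k + mesh x0 x1 n / 2)"
    unfolding eventually_at_right_field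
    by (intro exI[of _ "node x0 x1 n (Suc k)"]) (use assms in \<open>auto intro!: std_approx_cell\<close>)
qed

lemma refl_coeff_std_approx_node:
  fixes \<zeta> :: "real \<Rightarrow> real"
  assumes "x0 < x1" "j < n"
  defines "m \<equiv> \<lambda>j. node x0 x1 n j + mesh x0 x1 n / 2"
  shows "refl_coeff (std_approx x0 x1 \<zeta> n) (node x0 x1 n (Suc j)) =
    (\<zeta> (m j) - \<zeta> (m (Suc j))) / (\<zeta> (m j) + \<zeta> (m (Suc j)))"
  unfolding m_def using assms(1,2)
  by (intro refl_coeff_eqI std_approx_at_left std_approx_at_right) (auto simp: node_less_iff)

text \<open>Inside a cell both one-sided limits agree, which leaves the interior nodes. Only an
  inclusion is claimed, as neighbouring cells may carry equal values.\<close>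

lemma jumps_std_approx:
  assumes "x0 < x1"
  shows "jumps x0 x1 (std_approx x0 x1 \<zeta> n) \<subseteq> (\<lambda>j. node x0 x1 n (Suc j)) ` {..<n}"
proof
  fix x assume "x \<in> jumps x0 x1 (std_approx x0 x1 \<zeta> n)"
  then have x: "x0 < x" "x < x1" and r: "refl_coeff (std_approx x0 x1 \<zeta> n) x \<noteq> 0"
    by (auto simp: jumps_def)
  obtain k where k: "k \<le> n" "node x0 x1 n k < x" "x \<le> node x0 x1 n (Suc k)"
    using obtain_cell[OF assms x(1)] x(2) by (metis less_imp_le)
  have "x = node x0 x1 n (Suc k)"
  proof (rule ccontr)
    assume "x \<noteq> node x0 x1 n (Suc k)"
    then have "refl_coeff (std_approx x0 x1 \<zeta> n) x = 0"
      using refl_coeff_eqI[OF std_approx_at_left[OF assms k] std_approx_at_right[OF assms k(1)]] k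
      by simp
    then show False using r by simp
  qed
  \<comment> \<open>The node with index \<open>Suc n\<close> is \<open>x1\<close>, which the open
    interval excludes.\<close>
  moreover from this x have "k \<noteq> n" by (auto simp: node_last)
  ultimately show "x \<in> (\<lambda>j. node x0 x1 n (Suc j)) ` {..<n}"
    using k by auto
qed

text \<open>Surjectivity of \<open>1 - Z_op\<close> turns the inverse into the fixed-point equation
  \<open>F = 1 + Z_op F\<close>. Extending the sum from the jumps below \<open>z\<close> to the
  first \<open>k\<close> interior nodes only adds nodes with coefficient zero.\<close>

lemma sing_harm_exp_std_approx:
  fixes x0 x1 \<omega> z :: real and \<zeta> :: "real \<Rightarrow> real"
  assumes "x0 < x1" "k \<le> n" "node x0 x1 n k < z" "z \<le> node x0 x1 n (Suc k)"
  defines "\<eta> \<equiv> std_approx x0 x1 \<zeta> n"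
  defines "p \<equiv> \<lambda>j. node x0 x1 n (Suc j)"
  shows "sing_harm_exp x0 x1 \<eta> z \<omega> =
    1 + (\<Sum>j<k. of_real (refl_coeff \<eta> (p j)) * exp (2 * \<i> * of_real (p j - x0) * of_real \<omega>)
           * cnj (sing_harm_exp x0 x1 \<eta> (p j) \<omega>))"
proof -
  define F where "F z = sing_harm_exp x0 x1 \<eta> z \<omega>" for z
  define c where "c x = of_real (refl_coeff \<eta> x) * exp (2 * \<i> * of_real (x - x0) * of_real \<omega>)" for x
  have "finite (jumps x0 x1 \<eta>)"
    unfolding \<eta>_def by (rule finite_subset[OF jumps_std_approx[OF assms(1)]]) simp
  then have "bij (\<lambda>f z. f z - Z_op x0 x1 \<eta> \<omega> f z)"
    unfolding Z_op_def by (rule triangular_bij)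
  then have "(\<lambda>z. F z - Z_op x0 x1 \<eta> \<omega> F z) = (\<lambda>_. 1)"
    unfolding F_def sing_harm_exp_def
    using surj_f_inv_f[OF bij_is_surj, of "\<lambda>f z. f z - Z_op x0 x1 \<eta> \<omega> f z" "\<lambda>_. 1"] by simp
  then have "F z = 1 + Z_op x0 x1 \<eta> \<omega> F z"
    by (metis diff_eq_eq)
  also have "Z_op x0 x1 \<eta> \<omega> F z = (\<Sum>x \<in> p ` {..<k}. c x * cnj (F x))"
    unfolding Z_op_def c_def
  proof (rule sum.mono_neutral_left)
    show "{x \<in> jumps x0 x1 \<eta>. x < z} \<subseteq> p ` {..<k}"
    proof
      fix x assume "x \<in> {x \<in> jumps x0 x1 \<eta>. x < z}"
      then obtain j where j: "x = p j" "p j < z"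
        using jumps_std_approx[OF assms(1), of \<zeta> n] by (auto simp: \<eta>_def p_def)
      then have "node x0 x1 n (Suc j) < node x0 x1 n (Suc k)"
        using assms(4) by (simp add: p_def)
      then show "x \<in> p ` {..<k}" using j assms(1) by (simp add: node_less_iff)
    qed
    show "\<forall>x \<in> p ` {..<k} - {x \<in> jumps x0 x1 \<eta>. x < z}.
        of_real (refl_coeff \<eta> x) * exp (2 * \<i> * of_real (x - x0) * of_real \<omega>) * cnj (F x) = 0"
    proof
      fix x assume "x \<in> p ` {..<k} - {x \<in> jumps x0 x1 \<eta>. x < z}"
      then obtain j where j: "j < k" "x = p j" and x: "x \<notin> jumps x0 x1 \<eta> \<or> \<not> x < z" by auto
      have "x < z"
        using j assms(1,3) node_le_iff[OF assms(1), of n "Suc j" k] by (auto simp: p_def)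
      moreover have "x0 < x" "x < x1"
        using j assms(1,2) node_less_iff[OF assms(1), of n 0 "Suc j"]
          node_less_iff[OF assms(1), of n "Suc j" "Suc n"] by (auto simp: p_def node_last)
      ultimately have "refl_coeff \<eta> x = 0"
        using x by (auto simp: jumps_def)
      then show "of_real (refl_coeff \<eta> x) * exp (2 * \<i> * of_real (x - x0) * of_real \<omega>) * cnj (F x) = 0"
        by simp
    qed
  qed simp
  also have "\<dots> = (\<Sum>j<k. c (p j) * cnj (F (p j)))"
  proof (subst sum.reindex)
    have "p i = p j \<longleftrightarrow> i = j" for i j
      using mesh_pos[OF assms(1), of n] by (simp add: p_def node_def)
    then show "inj_on p {..<k}" by (auto simp: inj_on_def)
  qed simp
  finally show ?thesis unfolding F_def c_def .
qed

subsection \<open>The Volterra equation\<close>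

locale bounded_coefficient =
  fixes x0 A \<omega> :: real and \<beta> :: "real \<Rightarrow> real"
  assumes borel_coefficient [measurable]: "\<beta> \<in> borel_measurable borel"
    and coefficient_bound: "\<bar>\<beta> x\<bar> \<le> A"
    and bound_pos: "A > 0"
begin

definition phase :: "real \<Rightarrow> complex" where
  "phase s = exp (2 * \<i> * of_real (s - x0) * of_real \<omega>)"

definition kernel :: "real \<Rightarrow> complex" where
  "kernel s = of_real (\<beta> s) * phase s"

abbreviation harm_term :: "nat \<Rightarrow> real \<Rightarrow> complex" where
  "harm_term j z \<equiv> reg_harm_term x0 \<beta> z \<omega> j"

text \<open>The indicator belongs to the integrand, so a term of the series is an integral over the
  whole product space, where Fubini can separate the variables.\<close>

definition simplex_integrand :: "real \<Rightarrow> nat \<Rightarrow> (nat \<Rightarrow> real) \<Rightarrow> complex" where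
  "simplex_integrand z j s = indicator (ordered_simplex x0 z j) s *\<^sub>R
     (exp (2 * \<i> * of_real \<omega> * of_real (\<Sum>\<nu>=1..j. (-1) ^ (j - \<nu>) * (s \<nu> - x0)))
        * of_real (\<Prod>\<nu>=1..j. \<beta> (s \<nu>)))"

lemma norm_phase [simp]: "norm (phase s) = 1"
  by (simp add: phase_def)

lemma borel_phase [measurable]: "phase \<in> borel_measurable borel"
  unfolding phase_def by measurable

lemma borel_kernel [measurable]: "kernel \<in> borel_measurable borel"
  unfolding kernel_def by measurable

lemma norm_kernel_le: "norm (kernel s) \<le> A"
  by (simp add: kernel_def norm_mult coefficient_bound)

lemma harm_term_eq:
  "harm_term j z = integral\<^sup>L (Pi\<^sub>M {1..j} (\<lambda>_. lborel)) (simplex_integrand z j)"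
  unfolding reg_harm_term_def set_lebesgue_integral_def simplex_integrand_def ..

text \<open>Written as finitely many comparisons of coordinates, the indicator is visibly
  measurable, also jointly in \<open>s\<close> and \<open>z\<close>.\<close>

lemma indicator_ordered_simplex:
  "indicator (ordered_simplex x0 z j) s = (if (\<forall>\<nu>\<in>{1..j}. x0 < s \<nu> \<and> s \<nu> < z) \<and>
     (\<forall>a\<in>{1..j}. \<forall>b\<in>{1..j}. a < b \<longrightarrow> s a < s b) then 1 else (0::real))"
  by (auto simp: ordered_simplex_def strict_mono_on_def indicator_def)

lemma borel_simplex_integrand [measurable]:
  "simplex_integrand z j \<in> borel_measurable (Pi\<^sub>M {1..j} (\<lambda>_. lborel))"
  unfolding simplex_integrand_def indicator_ordered_simplex by measurable

text \<open>The majorant is a product of functions of one variable each, so its integrability over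
  the product space reduces to that of a single factor.\<close>

lemma norm_simplex_integrand_le:
  "norm (simplex_integrand z j s) \<le> (\<Prod>\<nu>=1..j. A * indicator {x0<..<z} (s \<nu>))"
proof (cases "s \<in> ordered_simplex x0 z j")
  case True
  have "norm (simplex_integrand z j s) = (\<Prod>\<nu>=1..j. \<bar>\<beta> (s \<nu>)\<bar>)"
    using True by (simp add: simplex_integrand_def norm_mult abs_prod del: of_real_prod)
  also have "\<dots> \<le> (\<Prod>\<nu>=1..j. A * indicator {x0<..<z} (s \<nu>))"
    using True coefficient_bound by (intro prod_mono) (auto simp: ordered_simplex_def)
  finally show ?thesis .
next
  case False
  then show ?thesis
    using bound_pos by (auto simp: simplex_integrand_def intro!: prod_nonneg)
qed

lemma integrable_simplex_integrand:
  "integrable (Pi\<^sub>M {1..j} (\<lambda>_. lborel)) (simplex_integrand z j)"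
proof -
  interpret product_sigma_finite "\<lambda>_::nat. lborel :: real measure" ..
  have "integrable lborel (\<lambda>x. A * indicator {x0<..<z} x)"
    by (intro integrable_mult_right) (simp add: integrable_indicator_iff emeasure_bounded_finite[unfolded infinity_ennreal_def])
  then have "integrable (Pi\<^sub>M {1..j} (\<lambda>_. lborel)) (\<lambda>s. \<Prod>\<nu>=1..j. A * indicator {x0<..<z} (s \<nu>))"
    by (intro product_integrable_prod) auto
  then show ?thesis
    using order_trans[OF norm_simplex_integrand_le abs_ge_self]
    by (elim Bochner_Integration.integrable_bound[OF _ borel_simplex_integrand]) (auto intro!: AE_I2)
qed

lemma harm_term_0 [simp]: "harm_term 0 z = 1"
  unfolding harm_term_eq simplex_integrand_def
  by (simp add: ordered_simplex_def PiM_empty lebesgue_integral_count_space_finite)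

text \<open>Once the largest variable \<open>t\<close> is fixed, the others range over the simplex
  below \<open>t\<close>. The alternating sum becomes \<open>t - x0\<close> minus the sum for
  \<open>j\<close> variables, and since \<open>\<beta>\<close> is real this minus sign amounts to
  complex conjugation. The family \<open>x\<close> has to agree with \<open>s\<close> only on
  \<open>{1..j}\<close>, which fits the merged families in Fubini's theorem.\<close>

lemma simplex_integrand_Suc:
  assumes "\<And>\<nu>. \<nu> \<in> {1..j} \<Longrightarrow> s \<nu> = x \<nu>"
  shows "simplex_integrand z (Suc j) s =
    indicator {x0<..<z} (s (Suc j)) *\<^sub>R (kernel (s (Suc j)) * cnj (simplex_integrand (s (Suc j)) j x))"
proof -
  define t where "t = s (Suc j)"
  have ind: "indicator (ordered_simplex x0 z (Suc j)) s =
      indicator {x0<..<z} t * (indicator (ordered_simplex x0 t j) x :: real)"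
  proof -
    have "s \<in> ordered_simplex x0 z (Suc j) \<longleftrightarrow> t \<in> {x0<..<z} \<and> x \<in> ordered_simplex x0 t j"
    proof
      assume "s \<in> ordered_simplex x0 z (Suc j)"
      then have b: "\<And>\<nu>. \<nu> \<in> {1..Suc j} \<Longrightarrow> x0 < s \<nu> \<and> s \<nu> < z"
        and m: "\<And>a b. a \<in> {1..Suc j} \<Longrightarrow> b \<in> {1..Suc j} \<Longrightarrow> a < b \<Longrightarrow> s a < s b"
        by (auto simp: ordered_simplex_def strict_mono_on_def)
      show "t \<in> {x0<..<z} \<and> x \<in> ordered_simplex x0 t j"
        unfolding ordered_simplex_def strict_mono_on_def t_def
      proof (intro conjI CollectI ballI allI impI)
        show "s (Suc j) \<in> {x0<..<z}" using b[of "Suc j"] by simp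
      next
        fix \<nu> assume "\<nu> \<in> {1..j}"
        then show "x0 < x \<nu>" "x \<nu> < s (Suc j)"
          using assms[of \<nu>] b[of \<nu>] m[of \<nu> "Suc j"] by auto
      next
        fix a b assume "a \<in> {1..j} \<and> b \<in> {1..j} \<and> a < b"
        then show "x a < x b"
          using assms[of a] assms[of b] m[of a b] by auto
      qed
    next
      assume r: "t \<in> {x0<..<z} \<and> x \<in> ordered_simplex x0 t j"
      then have b: "\<And>\<nu>. \<nu> \<in> {1..j} \<Longrightarrow> x0 < s \<nu> \<and> s \<nu> < t"
        and m: "\<And>a b. a \<in> {1..j} \<Longrightarrow> b \<in> {1..j} \<Longrightarrow> a < b \<Longrightarrow> s a < s b"
        using assms by (auto simp: ordered_simplex_def strict_mono_on_def)
      have "x0 < s \<nu> \<and> s \<nu> < z" if "\<nu> \<in> {1..Suc j}" for \<nu>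
        using that b[of \<nu>] r by (cases "\<nu> = Suc j") (auto simp: t_def)
      moreover have "s a < s b" if "a \<in> {1..Suc j}" "b \<in> {1..Suc j}" "a < b" for a b
        using that b[of a] m[of a b] by (cases "b = Suc j") (auto simp: t_def)
      ultimately show "s \<in> ordered_simplex x0 z (Suc j)"
        by (auto simp: ordered_simplex_def strict_mono_on_def)
    qed
    then show ?thesis by (auto simp: indicator_def)
  qed
  have sum: "(\<Sum>\<nu>=1..Suc j. (-1) ^ (Suc j - \<nu>) * (s \<nu> - x0)) =
      (t - x0) - (\<Sum>\<nu>=1..j. (-1) ^ (j - \<nu>) * (x \<nu> - x0))"
  proof -
    have "(\<Sum>\<nu>=1..j. (-1) ^ (Suc j - \<nu>) * (s \<nu> - x0)) =
        (\<Sum>\<nu>=1..j. - ((-1) ^ (j - \<nu>) * (x \<nu> - x0)))"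
      using assms by (intro sum.cong) (auto simp: Suc_diff_le)
    then show ?thesis by (simp add: t_def sum_negf)
  qed
  have prod: "(\<Prod>\<nu>=1..Suc j. \<beta> (s \<nu>)) = \<beta> t * (\<Prod>\<nu>=1..j. \<beta> (x \<nu>))"
    using assms by (simp add: t_def)
  define a where "a = (\<Sum>\<nu>=1..j. (-1) ^ (j - \<nu>) * (x \<nu> - x0))"
  have "exp (2 * \<i> * of_real \<omega> * of_real (t - x0 - a)) =
      phase t * cnj (exp (2 * \<i> * of_real \<omega> * of_real a))"
    by (simp add: phase_def exp_cnj flip: exp_add) (simp add: algebra_simps)
  then show ?thesis
    unfolding simplex_integrand_def ind sum prod t_def[symmetric] kernel_def a_def[symmetric]
    by (simp add: scaleR_conv_of_real algebra_simps del: of_real_prod)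
qed

lemma borel_harm_term [measurable]: "harm_term j \<in> borel_measurable borel"
proof -
  interpret product_sigma_finite "\<lambda>_::nat. lborel :: real measure" ..
  \<comment> \<open>Sigma-finiteness of the product measure gives measurability of the integral in
    its parameter \<open>z\<close>.\<close>
  interpret finite_product_sigma_finite "\<lambda>_::nat. lborel :: real measure" "{1..j}"
    by standard simp
  have "(\<lambda>z. integral\<^sup>L (Pi\<^sub>M {1..j} (\<lambda>_. lborel)) (simplex_integrand z j)) \<in> borel_measurable borel"
    unfolding simplex_integrand_def indicator_ordered_simplex by measurable
  then show ?thesis by (simp add: harm_term_eq)
qed

lemma borel_cnj_harm_term [measurable]: "(\<lambda>z. cnj (harm_term j z)) \<in> borel_measurable borel"
  by (rule borel_measurable_continuous_on[OF _ borel_harm_term]) (intro continuous_intros)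

lemma harm_term_Suc:
  "harm_term (Suc j) z = (LINT s|lborel. indicator {x0<..<z} s *\<^sub>R (kernel s * cnj (harm_term j s)))"
proof -
  interpret product_sigma_finite "\<lambda>_::nat. lborel :: real measure" ..
  let ?M = "\<lambda>I::nat set. Pi\<^sub>M I (\<lambda>_. lborel :: real measure)"
  let ?g = "\<lambda>t. indicator {x0<..<z} t *\<^sub>R (kernel t * cnj (harm_term j t))"
  have I: "{1..Suc j} = {Suc j} \<union> {1..j}" by auto
  have "harm_term (Suc j) z = integral\<^sup>L (?M ({Suc j} \<union> {1..j})) (simplex_integrand z (Suc j))"
    unfolding harm_term_eq I ..
  also have "\<dots> = (\<integral>x. (\<integral>y. simplex_integrand z (Suc j) (merge {Suc j} {1..j} (x, y))
      \<partial>?M {1..j}) \<partial>?M {Suc j})"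
    using integrable_simplex_integrand[of "Suc j" z, unfolded I]
    by (intro product_integral_fold) auto
  \<comment> \<open>For a fixed top coordinate, indicator and kernel leave the inner integral, and
    conjugation commutes with it.\<close>
  also have "\<dots> = (\<integral>x. ?g (x (Suc j)) \<partial>?M {Suc j})"
  proof (intro Bochner_Integration.integral_cong refl)
    fix x
    have "simplex_integrand z (Suc j) (merge {Suc j} {1..j} (x, y)) =
        indicator {x0<..<z} (x (Suc j)) *\<^sub>R (kernel (x (Suc j)) * cnj (simplex_integrand (x (Suc j)) j y))" for y
      by (subst simplex_integrand_Suc[of _ _ y]) (auto simp: merge_def)
    then show "(\<integral>y. simplex_integrand z (Suc j) (merge {Suc j} {1..j} (x, y)) \<partial>?M {1..j}) = ?g (x (Suc j))"
      by (simp add: harm_term_eq)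
  qed
  also have "\<dots> = integral\<^sup>L lborel ?g"
    by (rule product_integral_singleton) (use borel_cnj_harm_term in measurable)
  finally show ?thesis .
qed

section \<open>Convergence of the series and the integral equation\<close>

lemma exp_weight_has_integral:
  assumes "x0 \<le> z"
  shows "has_bochner_integral lborel (\<lambda>s. A * exp (2 * A * (s - x0)) * indicator {x0..z} s)
           ((exp (2 * A * (z - x0)) - 1) / 2)"
proof -
  have "has_bochner_integral lborel (\<lambda>s. A * exp (2 * A * (s - x0)) * indicator {x0..z} s)
          (exp (2 * A * (z - x0)) / 2 - exp (2 * A * (x0 - x0)) / 2)"
    using assms by (intro has_bochner_integral_FTC_Icc_real)
      (auto intro!: derivative_eq_intros continuous_intros)
  then show ?thesis by (simp add: diff_divide_distrib)
qed

text \<open>The weight \<open>exp (2 * A * (s - x0))\<close> makes the Volterra operator a contraction with factor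
  \<open>1 / 2\<close>.\<close>

lemma volterra_bound:
  fixes u :: "real \<Rightarrow> complex"
  assumes u [measurable]: "u \<in> borel_measurable borel" and "x0 \<le> z" and c: "c \<ge> 0"
    and u_le: "\<And>s. s \<in> {x0<..<z} \<Longrightarrow> norm (u s) \<le> c * exp (2 * A * (s - x0))"
  defines "g \<equiv> \<lambda>s. indicator {x0<..<z} s *\<^sub>R (kernel s * cnj (u s))"
  shows "integrable lborel g"
    and "(LINT s|lborel. norm (g s)) \<le> c / 2 * exp (2 * A * (z - x0))"
proof -
  let ?w = "\<lambda>s. c * (A * exp (2 * A * (s - x0)) * indicator {x0..z} s)"
  have cnj_u [measurable]: "(\<lambda>s. cnj (u s)) \<in> borel_measurable borel"
    by (rule borel_measurable_continuous_on[OF _ u]) (intro continuous_intros)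
  have g_le: "norm (g s) \<le> ?w s" for s
  proof (cases "s \<in> {x0<..<z}")
    case True
    then show ?thesis
      using mult_mono[OF norm_kernel_le[of s] u_le[OF True]] bound_pos
      by (simp add: g_def norm_mult algebra_simps)
  next
    case False
    then show ?thesis
      using c bound_pos by (simp add: g_def)
  qed
  have w: "has_bochner_integral lborel ?w (c * ((exp (2 * A * (z - x0)) - 1) / 2))"
    by (intro has_bochner_integral_mult_right exp_weight_has_integral assms)
  then have w': "integrable lborel ?w" by (simp add: has_bochner_integral_iff)
  have "g \<in> borel_measurable lborel"
    unfolding g_def by measurable
  then show g: "integrable lborel g"
    using order_trans[OF g_le abs_ge_self]
    by (intro Bochner_Integration.integrable_bound[OF w'] AE_I2) auto
  have "(LINT s|lborel. norm (g s)) \<le> (LINT s|lborel. ?w s)"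
    using g w' g_le by (intro integral_mono integrable_norm) auto
  also have "\<dots> = c * ((exp (2 * A * (z - x0)) - 1) / 2)"
    using w by (simp add: has_bochner_integral_iff)
  also have "\<dots> \<le> c / 2 * exp (2 * A * (z - x0))"
    using c by (simp add: algebra_simps)
  finally show "(LINT s|lborel. norm (g s)) \<le> c / 2 * exp (2 * A * (z - x0))" .
qed

text \<open>The recursion is one application of the Volterra operator, so
  \<open>volterra_bound\<close> with \<open>c = (1/2) ^ j\<close> gains another factor 1/2. The
  induction starts because the weight is at least 1 to the right of \<open>x0\<close>.\<close>

lemma norm_harm_term_le:
  assumes "x0 \<le> z"
  shows "norm (harm_term j z) \<le> (1/2) ^ j * exp (2 * A * (z - x0))"
  using assms
proof (induction j arbitrary: z)
  case 0
  then show ?case using bound_pos by simp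
next
  case (Suc j)
  have "norm (harm_term (Suc j) z) \<le>
      (LINT s|lborel. norm (indicator {x0<..<z} s *\<^sub>R (kernel s * cnj (harm_term j s))))"
    unfolding harm_term_Suc by (rule integral_norm_bound)
  also have "\<dots> \<le> (1/2) ^ j / 2 * exp (2 * A * (z - x0))"
    using Suc by (intro volterra_bound) auto
  finally show ?case by simp
qed

abbreviation harm_exp :: "real \<Rightarrow> complex" where
  "harm_exp z \<equiv> reg_harm_exp x0 \<beta> z \<omega>"

lemma summable_geometric_weight: "summable (\<lambda>j. (1/2) ^ j * (c::real))"
  by (rule summable_mult2, rule summable_geometric) simp

lemma summable_norm_harm_term: "x0 \<le> z \<Longrightarrow> summable (\<lambda>j. norm (harm_term j z))"
  by (rule summable_comparison_test[OF _ summable_geometric_weight[of "exp (2 * A * (z - x0))"]])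
     (use norm_harm_term_le in simp)

lemma harm_exp_eq_suminf:
  assumes "x0 \<le> z"
  shows "harm_exp z = (\<Sum>j. harm_term j z)"
  unfolding reg_harm_exp_def
  using suminf_split_head[OF summable_norm_cancel[OF summable_norm_harm_term[OF assms]]] by simp

lemma norm_harm_exp_le:
  assumes "x0 \<le> z"
  shows "norm (harm_exp z) \<le> 2 * exp (2 * A * (z - x0))"
proof -
  have "norm (harm_exp z) \<le> (\<Sum>j. norm (harm_term j z))"
    unfolding harm_exp_eq_suminf[OF assms] by (intro summable_norm summable_norm_harm_term assms)
  also have "\<dots> \<le> (\<Sum>j. (1/2) ^ j * exp (2 * A * (z - x0)))"
    using assms by (intro suminf_le norm_harm_term_le summable_norm_harm_term summable_geometric_weight)
  also have "\<dots> = 2 * exp (2 * A * (z - x0))"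
    by (subst suminf_mult2[symmetric]) (simp_all add: suminf_geometric)
  finally show ?thesis .
qed

lemma borel_harm_exp [measurable]: "harm_exp \<in> borel_measurable borel"
  unfolding reg_harm_exp_def by measurable

text \<open>The recursion is summed over all indices. Series and integral may be exchanged because
  the integrals of the norms decay like \<open>(1/2) ^ j\<close>.\<close>

lemma harm_exp_volterra:
  assumes "x0 \<le> z"
  shows "harm_exp z = 1 + (LINT s|lborel. indicator {x0<..<z} s *\<^sub>R (kernel s * cnj (harm_exp s)))"
proof -
  let ?g = "\<lambda>j s. indicator {x0<..<z} s *\<^sub>R (kernel s * cnj (harm_term j s))"
  have int: "integrable lborel (?g j)"
    and le: "(LINT s|lborel. norm (?g j s)) \<le> (1/2) ^ j * (1/2 * exp (2 * A * (z - x0)))" for j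
    using volterra_bound[of "harm_term j" z "(1/2) ^ j"] assms norm_harm_term_le by auto
  have cnj_sums: "(\<lambda>j. cnj (harm_term j s)) sums cnj (harm_exp s)" if "x0 \<le> s" for s
    unfolding harm_exp_eq_suminf[OF that] sums_cnj
    by (rule summable_sums[OF summable_norm_cancel[OF summable_norm_harm_term[OF that]]])
  have g_sums: "(\<lambda>j. ?g j s) sums (indicator {x0<..<z} s *\<^sub>R (kernel s * cnj (harm_exp s)))" for s
    using cnj_sums[of s]
    by (cases "s \<in> {x0<..<z}") (auto intro!: sums_mult)
  \<comment> \<open>The defining series starts at index 1, so the recursion turns it into integrals
    of all terms from index 0 on.\<close>
  have "harm_exp z = 1 + (\<Sum>j. LINT s|lborel. ?g j s)"
    unfolding reg_harm_exp_def harm_term_Suc ..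
  also have "(\<Sum>j. LINT s|lborel. ?g j s) = (LINT s|lborel. (\<Sum>j. ?g j s))"
  proof (rule integral_suminf[symmetric])
    have "summable (\<lambda>j. norm (?g j s))" for s
      using summable_mult[OF summable_norm_harm_term[of s], of "norm (kernel s)"]
      by (cases "s \<in> {x0<..<z}") (auto simp: norm_mult)
    then show "AE s in lborel. summable (\<lambda>j. norm (?g j s))" by simp
    show "summable (\<lambda>j. LINT s|lborel. norm (?g j s))"
    proof (rule summable_comparison_test[OF _ summable_geometric_weight], intro exI allI impI)
      show "norm (LINT s|lborel. norm (?g j s)) \<le> (1/2) ^ j * (1/2 * exp (2 * A * (z - x0)))" for j
        using le[of j] by (subst real_norm_def, subst abs_of_nonneg) (auto intro!: integral_nonneg_AE)
    qed
  qed (rule int)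
  also have "\<dots> = (LINT s|lborel. indicator {x0<..<z} s *\<^sub>R (kernel s * cnj (harm_exp s)))"
    using sums_unique[OF g_sums] by simp
  finally show ?thesis .
qed

text \<open>Passage from the Lebesgue integral over the interval from \<open>x0\<close> to a gauge
  integral over \<open>{w..z}\<close>, the form in which increments over cells are combined with the
  fundamental theorem of calculus.\<close>

lemma harm_exp_has_integral:
  assumes "x0 \<le> w" "w \<le> z"
  shows "((\<lambda>s. kernel s * cnj (harm_exp s)) has_integral (harm_exp z - harm_exp w)) {w..z}"
proof -
  let ?f = "\<lambda>s. kernel s * cnj (harm_exp s)"
  have from_x0: "?f integrable_on {x0..z} \<and> harm_exp z = 1 + integral {x0..z} ?f" if "x0 \<le> z" for z
  proof -
    have "set_integrable lborel {x0<..<z} ?f"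
      unfolding set_integrable_def
      using volterra_bound(1)[of harm_exp z 2] norm_harm_exp_le that by simp
    note f = set_borel_integral_eq_integral[OF this]
    then show ?thesis
      using harm_exp_volterra[OF that]
      by (simp add: integrable_on_open_interval_real integral_open_interval_real set_lebesgue_integral_def)
  qed
  have f: "?f integrable_on {x0..z}" "harm_exp z = 1 + integral {x0..z} ?f"
    using from_x0[of z] assms by auto
  have "integral {x0..w} ?f + integral {w..z} ?f = integral {x0..z} ?f"
    using assms f by (intro Henstock_Kurzweil_Integration.integral_combine) auto
  moreover have "?f integrable_on {w..z}"
    using f(1) by (rule integrable_subinterval_real) (use assms in auto)
  ultimately show ?thesis
    using f(2) from_x0[of w] assms by (simp add: has_integral_iff eq_diff_eq add.commute)
qed

text \<open>The common factor of the two equations for the regular exponential: the exact one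
  integrates it against \<open>\<beta> s ds\<close>, the approximate discrete one sums it against
  reflection coefficients.\<close>

definition twist :: "real \<Rightarrow> complex" where
  "twist s = phase s * cnj (harm_exp s)"

lemma harm_exp_has_integral_twist:
  assumes "x0 \<le> w" "w \<le> z"
  shows "((\<lambda>s. of_real (\<beta> s) * twist s) has_integral (harm_exp z - harm_exp w)) {w..z}"
  using harm_exp_has_integral[OF assms] by (simp add: twist_def kernel_def mult.assoc)

lemma harm_exp_start: "harm_exp x0 = 1"
  using harm_exp_volterra[of x0] by simp

section \<open>Lipschitz estimates for the regular exponential\<close>

lemma norm_harm_exp_le_const:
  assumes "x0 \<le> s" "s \<le> x1"
  shows "norm (harm_exp s) \<le> 2 * exp (2 * A * (x1 - x0))"
proof -
  have "2 * exp (2 * A * (s - x0)) \<le> 2 * exp (2 * A * (x1 - x0))"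
    using assms bound_pos by (intro mult_left_mono) auto
  then show ?thesis using norm_harm_exp_le[OF assms(1)] by linarith
qed

lemma norm_twist: "norm (twist s) = norm (harm_exp s)"
  by (simp add: twist_def norm_mult)

lemma harm_exp_lipschitz:
  assumes "x0 \<le> w" "w \<le> z" and bound: "\<And>s. s \<in> {w..z} \<Longrightarrow> norm (harm_exp s) \<le> M"
  shows "norm (harm_exp z - harm_exp w) \<le> A * M * (z - w)"
proof -
  have "M \<ge> 0" using order_trans[OF norm_ge_zero bound[of w]] assms(2) by simp
  have "norm (harm_exp z - harm_exp w) \<le> A * M * measure lborel (cbox w z)"
  proof (rule has_integral_bound)
    show "((\<lambda>s. of_real (\<beta> s) * twist s) has_integral (harm_exp z - harm_exp w)) (cbox w z)"
      using harm_exp_has_integral_twist[OF assms(1,2)] by simp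
    show "norm (of_real (\<beta> s) * twist s) \<le> A * M" if "s \<in> cbox w z" for s
      using mult_mono[OF coefficient_bound[of s] bound[of s]] that bound_pos
      by (simp add: norm_mult norm_twist)
  qed (use bound_pos \<open>M \<ge> 0\<close> in simp)
  then show ?thesis using assms(2) by simp
qed

lemma phase_lipschitz:
  assumes "w \<le> z"
  shows "norm (phase z - phase w) \<le> 2 * \<bar>\<omega>\<bar> * (z - w)"
proof -
  have "norm (phase z - phase w) \<le> 2 * \<bar>\<omega>\<bar> * measure lborel (cbox w z)"
  proof (rule has_integral_bound)
    have "((\<lambda>s. 2 * \<i> * of_real \<omega> * phase s) has_integral (phase z - phase w)) {w..z}"
    proof (rule fundamental_theorem_of_calculus[OF assms])
      fix s
      \<comment> \<open>The phase is differentiated as a function of a complex variable and then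
        restricted to the real line.\<close>
      have "((\<lambda>s. exp (2 * \<i> * (s - of_real x0) * of_real \<omega>)) has_field_derivative
          2 * \<i> * of_real \<omega> * phase s) (at (of_real s))"
        by (auto intro!: derivative_eq_intros simp: phase_def)
      then have "((\<lambda>s. exp (2 * \<i> * (of_real s - of_real x0) * of_real \<omega>)) has_vector_derivative
          2 * \<i> * of_real \<omega> * phase s) (at s within {w..z})"
        by (rule has_vector_derivative_real_field)
      then show "(phase has_vector_derivative 2 * \<i> * of_real \<omega> * phase s) (at s within {w..z})"
        by (simp add: phase_def[abs_def])
    qed
    then show "((\<lambda>s. 2 * \<i> * of_real \<omega> * phase s) has_integral (phase z - phase w)) (cbox w z)"
      by simp
  qed (auto simp: norm_mult)
  then show ?thesis using assms by simp
qed

lemma twist_lipschitz: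
  assumes "x0 \<le> w" "w \<le> z" and bound: "\<And>s. s \<in> {w..z} \<Longrightarrow> norm (harm_exp s) \<le> M"
  shows "norm (twist z - twist w) \<le> (2 * \<bar>\<omega>\<bar> * M + A * M) * (z - w)"
proof -
  have M: "norm (harm_exp w) \<le> M" using bound assms by simp
  have "twist z - twist w = (phase z - phase w) * cnj (harm_exp w) + phase z * cnj (harm_exp z - harm_exp w)"
    by (simp add: twist_def algebra_simps)
  then have "norm (twist z - twist w) \<le>
      norm (phase z - phase w) * norm (harm_exp w) + norm (harm_exp z - harm_exp w)"
    using norm_triangle_ineq[of "(phase z - phase w) * cnj (harm_exp w)" "phase z * cnj (harm_exp z - harm_exp w)"]
    by (simp only: norm_mult complex_mod_cnj norm_phase mult_1)
  also have "\<dots> \<le> 2 * \<bar>\<omega>\<bar> * (z - w) * M + A * M * (z - w)"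
    using assms M phase_lipschitz[OF assms(2)] harm_exp_lipschitz[OF assms]
    by (intro add_mono mult_mono) auto
  finally show ?thesis by (simp add: algebra_simps)
qed

end

subsection \<open>The discretisation error\<close>

text \<open>Here \<open>c\<close> comes from being bounded away from zero, \<open>B\<close> from the
  regulated derivative and \<open>W\<close> from the compact set of frequencies. One
  \<open>\<omega>\<close> is fixed, but the constants defined below mention only \<open>W\<close>;
  this makes the estimate uniform in the frequency.\<close>

locale impedance =
  fixes x0 x1 \<omega> c B W :: real and \<zeta> :: "real \<Rightarrow> real"
  assumes interval: "x0 < x1"
    and lower_pos: "c > 0" and slope_pos: "B > 0"
    and lower: "\<And>x. x \<in> {x0<..<x1} \<Longrightarrow> c \<le> \<zeta> x"
    and deriv: "\<And>x. x \<in> {x0<..<x1} \<Longrightarrow> (\<zeta> has_real_derivative deriv \<zeta> x) (at x)"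
    and slope: "\<And>x. x \<in> {x0<..<x1} \<Longrightarrow> \<bar>deriv \<zeta> x\<bar> \<le> B"
    and cont_deriv: "continuous_on {x0<..<x1} (deriv \<zeta>)"
    and frequency: "\<bar>\<omega>\<bar> \<le> W"
begin

text \<open>Cut off outside the interval, where nothing is known about \<open>\<zeta>\<close>:
  \<open>bounded_coefficient\<close> asks for measurability and a bound on the whole line.\<close>

definition coeff :: "real \<Rightarrow> real" where
  "coeff x = indicator {x0<..<x1} x *\<^sub>R (- deriv \<zeta> x / (2 * \<zeta> x))"

lemma coeff_le: "\<bar>coeff x\<bar> \<le> B / (2 * c)"
proof (cases "x \<in> {x0<..<x1}")
  case True
  then have "\<bar>deriv \<zeta> x\<bar> / (2 * \<zeta> x) \<le> B / (2 * c)"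
    using lower[OF True] slope[OF True] lower_pos slope_pos by (intro frac_le) auto
  then show ?thesis
    using True lower[OF True] lower_pos by (simp add: coeff_def abs_mult)
qed (use lower_pos slope_pos in \<open>simp add: coeff_def\<close>)

lemma borel_coeff: "coeff \<in> borel_measurable borel"
proof -
  have "continuous_on {x0<..<x1} \<zeta>"
    using deriv by (meson DERIV_isCont continuous_at_imp_continuous_on)
  then have "continuous_on {x0<..<x1} (\<lambda>x. - deriv \<zeta> x / (2 * \<zeta> x))"
    using cont_deriv lower lower_pos by (intro continuous_intros) force+
  then show ?thesis
    unfolding coeff_def[abs_def] by (intro borel_measurable_continuous_on_indicator) auto
qed

sublocale bounded_coefficient x0 "B / (2 * c)" \<omega> coeff
  using coeff_le borel_coeff lower_pos slope_pos by unfold_locales auto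

lemma zeta_lipschitz:
  assumes "s \<in> {x0<..<x1}" "t \<in> {x0<..<x1}"
  shows "\<bar>\<zeta> s - \<zeta> t\<bar> \<le> B * \<bar>s - t\<bar>"
  using field_differentiable_bound[of "{x0<..<x1}" \<zeta> "deriv \<zeta>" B s t] assms slope
    has_field_derivative_at_within[OF deriv] by simp

text \<open>A bound for the regular exponential on \<open>{x0..x1}\<close>, from
  \<open>norm_harm_exp_le_const\<close> with \<open>A = B / (2 * c)\<close>.\<close>

definition growth :: real where
  "growth = 2 * exp (2 * (B / (2 * c)) * (x1 - x0))"

text \<open>A Lipschitz constant of \<open>twist\<close>, with \<open>W\<close> in place of the
  modulus of \<open>\<omega>\<close>.\<close>

definition twist_const :: real where
  "twist_const = 2 * W * growth + B / (2 * c) * growth"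

text \<open>The factor \<open>B\<close> bounds \<open>deriv \<zeta>\<close>. In the bracket, the
  first summand is the price of replacing \<open>2 * \<zeta> t\<close> by
  \<open>\<zeta> a + \<zeta> b\<close>, the second that of moving \<open>twist\<close> from
  \<open>t\<close> to \<open>p\<close>.\<close>

definition cell_const :: real where
  "cell_const = B * (growth * B / (4 * c\<^sup>2) + twist_const / (2 * c))"

lemma growth_pos: "growth > 0"
  by (simp add: growth_def)

lemma twist_const_nonneg: "twist_const \<ge> 0"
  using frequency growth_pos lower_pos slope_pos by (simp add: twist_const_def)

lemma cell_const_nonneg: "cell_const \<ge> 0"
  using twist_const_nonneg growth_pos lower_pos slope_pos by (simp add: cell_const_def)

lemma norm_harm_exp_le_growth: "s \<in> {x0..x1} \<Longrightarrow> norm (harm_exp s) \<le> growth"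
  unfolding growth_def by (rule norm_harm_exp_le_const) auto

lemma norm_twist_diff_le:
  assumes "s \<in> {x0..x1}" "t \<in> {x0..x1}"
  shows "norm (twist s - twist t) \<le> twist_const * \<bar>s - t\<bar>"
proof -
  have ordered: "norm (twist z - twist w) \<le> twist_const * (z - w)"
    if "x0 \<le> w" "w \<le> z" "z \<le> x1" for w z
  proof -
    have "norm (twist z - twist w) \<le> (2 * \<bar>\<omega>\<bar> * growth + B / (2 * c) * growth) * (z - w)"
      using that by (intro twist_lipschitz norm_harm_exp_le_growth) auto
    also have "\<dots> \<le> twist_const * (z - w)"
      unfolding twist_const_def using that frequency growth_pos
      by (intro mult_right_mono add_right_mono) auto
    finally show ?thesis .
  qed
  show ?thesis
    using ordered[of s t] ordered[of t s] assms by (cases "s \<le> t") (auto simp: norm_minus_commute)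
qed

text \<open>Over one cell both the increment of the regular exponential and the reflection coefficient are
  integrals against \<open>deriv \<zeta>\<close>, so it suffices to compare the integrands.\<close>

lemma cell_error:
  assumes "x0 < a" "a \<le> p" "p \<le> b" "b < x1"
  shows "norm (harm_exp b - harm_exp a - of_real ((\<zeta> a - \<zeta> b) / (\<zeta> a + \<zeta> b)) * twist p)
    \<le> cell_const * (b - a)\<^sup>2"
proof -
  define S where "S = \<zeta> a + \<zeta> b"
  define \<Delta> where "\<Delta> = b - a"
  have ab: "a \<in> {x0<..<x1}" "b \<in> {x0<..<x1}" "p \<in> {x0<..<x1}" "a \<le> b" using assms by auto
  have S: "S \<ge> 2 * c" using lower[OF ab(1)] lower[OF ab(2)] by (simp add: S_def)
  \<comment> \<open>The reflection coefficient is the integral of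
    \<open>- deriv \<zeta> t / S\<close>; subtracting it makes the second summand positive.\<close>
  let ?f = "\<lambda>t. of_real (coeff t) * twist t + of_real (deriv \<zeta> t) * (twist p / of_real S)"
  have "(deriv \<zeta> has_integral (\<zeta> b - \<zeta> a)) {a..b}"
    using ab assms
    by (intro fundamental_theorem_of_calculus)
       (auto simp flip: has_real_derivative_iff_has_vector_derivative
         intro!: has_field_derivative_at_within[OF deriv])
  then have "((\<lambda>t. complex_of_real (deriv \<zeta> t) * (twist p / of_real S)) has_integral
      of_real (\<zeta> b - \<zeta> a) * (twist p / of_real S)) {a..b}"
    by (intro has_integral_mult_left has_integral_of_real)
  then have "(?f has_integral (harm_exp b - harm_exp a) + of_real (\<zeta> b - \<zeta> a) * (twist p / of_real S)) {a..b}"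
    using ab assms by (intro has_integral_add harm_exp_has_integral_twist) auto
  also have "(harm_exp b - harm_exp a) + of_real (\<zeta> b - \<zeta> a) * (twist p / of_real S) =
      harm_exp b - harm_exp a - of_real ((\<zeta> a - \<zeta> b) / S) * twist p"
    by (simp add: diff_divide_distrib algebra_simps)
  finally have int: "(?f has_integral \<dots>) (cbox a b)" by simp
  have "norm (harm_exp b - harm_exp a - of_real ((\<zeta> a - \<zeta> b) / S) * twist p)
      \<le> (cell_const * \<Delta>) * measure lborel (cbox a b)"
  proof (rule has_integral_bound[OF _ int])
    show "0 \<le> cell_const * \<Delta>"
      using cell_const_nonneg ab by (simp add: \<Delta>_def)
    fix t assume "t \<in> cbox a b"
    then have t: "a \<le> t" "t \<le> b" "t \<in> {x0<..<x1}" using ab by auto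
    have z: "\<zeta> t \<ge> c" using lower t by blast
    have "\<bar>2 * \<zeta> t - S\<bar> \<le> \<bar>\<zeta> t - \<zeta> a\<bar> + \<bar>\<zeta> t - \<zeta> b\<bar>"
      unfolding S_def by linarith
    also have "\<dots> \<le> B * (t - a) + B * (b - t)"
      using zeta_lipschitz[OF t(3) ab(1)] zeta_lipschitz[OF t(3) ab(2)] t by simp
    finally have num: "\<bar>2 * \<zeta> t - S\<bar> \<le> B * \<Delta>"
      by (simp add: \<Delta>_def algebra_simps)
    have "\<bar>1 / S - 1 / (2 * \<zeta> t)\<bar> = \<bar>2 * \<zeta> t - S\<bar> / (S * (2 * \<zeta> t))"
      using S z lower_pos by (simp add: abs_mult field_simps)
    also have "\<dots> \<le> B * \<Delta> / ((2 * c) * (2 * c))"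
      using num S z lower_pos slope_pos ab by (intro frac_le mult_mono) (auto simp: \<Delta>_def)
    finally have inv: "\<bar>1 / S - 1 / (2 * \<zeta> t)\<bar> \<le> B * \<Delta> / (4 * c\<^sup>2)"
      by (simp add: power2_eq_square)
    have "norm (twist p - twist t) \<le> twist_const * \<bar>p - t\<bar>"
      using ab t by (intro norm_twist_diff_le) auto
    also have "\<dots> \<le> twist_const * \<Delta>"
      using t assms twist_const_nonneg by (intro mult_left_mono) (auto simp: \<Delta>_def)
    finally have tw: "norm (twist p - twist t) \<le> twist_const * \<Delta>" .
    \<comment> \<open>As \<open>coeff t\<close> equals
      \<open>- deriv \<zeta> t / (2 * \<zeta> t)\<close>, the derivative factors out and leaves two
      differences, each of the order of the cell length.\<close>
    have f: "?f t = of_real (deriv \<zeta> t) *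
        (twist p * of_real (1 / S - 1 / (2 * \<zeta> t)) + (twist p - twist t) / of_real (2 * \<zeta> t))"
      using t(3) S z lower_pos by (simp add: coeff_def field_simps)
    have "norm (?f t) \<le> B * (growth * (B * \<Delta> / (4 * c\<^sup>2)) + twist_const * \<Delta> / (2 * c))"
      unfolding f norm_mult
    proof (rule mult_mono)
      show "norm (complex_of_real (deriv \<zeta> t)) \<le> B" using slope[OF t(3)] by simp
      have "norm (twist p * of_real (1 / S - 1 / (2 * \<zeta> t))) \<le> growth * (B * \<Delta> / (4 * c\<^sup>2))"
        unfolding norm_mult norm_of_real norm_twist
        using ab inv growth_pos by (intro mult_mono norm_harm_exp_le_growth) auto
      moreover have "norm ((twist p - twist t) / of_real (2 * \<zeta> t)) \<le> twist_const * \<Delta> / (2 * c)"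
        unfolding norm_divide norm_of_real
        using tw z lower_pos twist_const_nonneg ab by (intro frac_le) (auto simp: \<Delta>_def)
      ultimately show "norm (twist p * of_real (1 / S - 1 / (2 * \<zeta> t)) + (twist p - twist t) / of_real (2 * \<zeta> t))
          \<le> growth * (B * \<Delta> / (4 * c\<^sup>2)) + twist_const * \<Delta> / (2 * c)"
        by (rule norm_triangle_mono)
    qed (use slope_pos in auto)
    also have "\<dots> = cell_const * \<Delta>"
      by (simp add: cell_const_def algebra_simps)
    finally show "norm (?f t) \<le> cell_const * \<Delta>" .
  qed
  then show ?thesis
    using ab by (simp add: S_def \<Delta>_def power2_eq_square mult.assoc)
qed

text \<open>The first summand pays for two stretches no longer than the mesh: from \<open>x0\<close>
  to the first midpoint, and between \<open>z\<close> and the midpoint of its cell. The second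
  collects the cell errors, which are quadratic in the mesh, while the number of cells times the
  mesh is \<open>x1 - x0\<close>.\<close>

definition total_const :: real where
  "total_const = 2 * (B / (2 * c)) * growth + (x1 - x0) * cell_const"

lemma total_const_nonneg: "total_const \<ge> 0"
  using growth_pos cell_const_nonneg interval lower_pos slope_pos by (simp add: total_const_def)

section \<open>Accumulation of the cell errors for the regular exponential\<close>

context
  fixes n :: nat
begin

text \<open>The comparison runs from midpoint to midpoint: each such stretch contains exactly one
  node, the possible jump, and its ends stay strictly inside the interval.\<close>

abbreviation midpoint :: "nat \<Rightarrow> real" where
  "midpoint j \<equiv> node x0 x1 n j + mesh x0 x1 n / 2"

abbreviation cell_refl :: "nat \<Rightarrow> real" where
  "cell_refl j \<equiv> (\<zeta> (midpoint j) - \<zeta> (midpoint (Suc j))) / (\<zeta> (midpoint j) + \<zeta> (midpoint (Suc j)))"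

lemma midpoint_mem: "j \<le> n \<Longrightarrow> midpoint j \<in> {x0<..<x1}"
  using node_le_iff[OF interval, of n 0 j] node_le_iff[OF interval, of n "Suc j" "Suc n"]
    mesh_pos[OF interval, of n] by (auto simp: node_last node_Suc)

text \<open>A telescoping sum: each step adds one \<open>cell_error\<close> with \<open>p\<close>
  the node between two midpoints. The start compares with the value 1 at \<open>x0\<close> by the
  Lipschitz bound.\<close>

lemma midpoint_error:
  assumes "k \<le> n"
  shows "norm (harm_exp (midpoint k) - 1 - (\<Sum>j<k. of_real (cell_refl j) * twist (node x0 x1 n (Suc j))))
    \<le> B / (2 * c) * growth * mesh x0 x1 n + real k * (cell_const * (mesh x0 x1 n)\<^sup>2)"
  using assms
proof (induction k)
  case 0
  have "norm (harm_exp (midpoint 0) - harm_exp x0) \<le> B / (2 * c) * growth * (midpoint 0 - x0)"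
    using midpoint_mem[of 0] by (intro harm_exp_lipschitz norm_harm_exp_le_growth) auto
  also have "\<dots> \<le> B / (2 * c) * growth * mesh x0 x1 n"
    using mesh_pos[OF interval, of n] growth_pos lower_pos slope_pos by (intro mult_left_mono) auto
  finally show ?case by (simp add: harm_exp_start)
next
  case (Suc k)
  have "norm (harm_exp (midpoint (Suc k)) - harm_exp (midpoint k) -
      of_real (cell_refl k) * twist (node x0 x1 n (Suc k)))
      \<le> cell_const * (midpoint (Suc k) - midpoint k)\<^sup>2"
    using midpoint_mem[of k] midpoint_mem[of "Suc k"] Suc.prems mesh_pos[OF interval, of n]
    by (intro cell_error) (auto simp: node_Suc)
  then have "norm (harm_exp (midpoint (Suc k)) - harm_exp (midpoint k) -
      of_real (cell_refl k) * twist (node x0 x1 n (Suc k))) \<le> cell_const * (mesh x0 x1 n)\<^sup>2"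
    by (simp add: node_Suc)
  from norm_triangle_mono[OF Suc.IH this] Suc.prems show ?case
    by (simp add: algebra_simps)
qed

text \<open>A Lipschitz step leads from the midpoint of the cell to \<open>z\<close>, on either side
  of it, without changing the number \<open>k\<close> of nodes that count. The \<open>k\<close>
  quadratic errors add up to a linear one because \<open>real k * mesh x0 x1 n\<close> is at most
  \<open>x1 - x0\<close>.\<close>

lemma point_error:
  assumes "k \<le> n" "node x0 x1 n k < z" "z \<le> node x0 x1 n (Suc k)"
  shows "norm (harm_exp z - 1 - (\<Sum>j<k. of_real (cell_refl j) * twist (node x0 x1 n (Suc j))))
    \<le> total_const * mesh x0 x1 n"
proof -
  let ?A = "B / (2 * c)" and ?h = "mesh x0 x1 n"
  note h = mesh_pos[OF interval, of n]
  have m: "midpoint k \<in> {x0<..<x1}" using assms(1) by (rule midpoint_mem)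
  have z: "x0 \<le> z" "z \<le> x1" "\<bar>z - midpoint k\<bar> \<le> ?h"
    using assms node_le_iff[OF interval, of n 0 k] node_le_iff[OF interval, of n "Suc k" "Suc n"] h
    by (auto simp: node_last node_Suc)
  have "norm (harm_exp z - harm_exp (midpoint k)) \<le> ?A * growth * \<bar>z - midpoint k\<bar>"
  proof (cases "midpoint k \<le> z")
    case True
    have "norm (harm_exp z - harm_exp (midpoint k)) \<le> ?A * growth * (z - midpoint k)"
      using True m z by (intro harm_exp_lipschitz norm_harm_exp_le_growth) auto
    then show ?thesis using True by simp
  next
    case False
    have "norm (harm_exp (midpoint k) - harm_exp z) \<le> ?A * growth * (midpoint k - z)"
      using False m z by (intro harm_exp_lipschitz norm_harm_exp_le_growth) auto
    then show ?thesis using False by (simp add: norm_minus_commute abs_if)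
  qed
  also have "\<dots> \<le> ?A * growth * ?h"
    using z growth_pos lower_pos slope_pos by (intro mult_left_mono) auto
  finally have "norm ((harm_exp z - harm_exp (midpoint k)) + (harm_exp (midpoint k) - 1 -
        (\<Sum>j<k. of_real (cell_refl j) * twist (node x0 x1 n (Suc j))))) \<le>
      ?A * growth * ?h + (?A * growth * ?h + real k * (cell_const * ?h\<^sup>2))"
    using midpoint_error[OF assms(1)] by (rule norm_triangle_mono)
  moreover have "a - 1 - s = (a - b) + (b - 1 - s)" for a b s :: complex by simp
  ultimately have "norm (harm_exp z - 1 - (\<Sum>j<k. of_real (cell_refl j) * twist (node x0 x1 n (Suc j)))) \<le>
      ?A * growth * ?h + (?A * growth * ?h + real k * (cell_const * ?h\<^sup>2))"
    by metis
  also have "real k * (cell_const * ?h\<^sup>2) \<le> (x1 - x0) * cell_const * ?h"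
  proof -
    have "real k * ?h \<le> real (Suc n) * ?h"
      using assms(1) h by (intro mult_right_mono) auto
    also have "\<dots> = x1 - x0" by (rule Suc_mult_mesh)
    finally have "(real k * ?h) * (cell_const * ?h) \<le> (x1 - x0) * (cell_const * ?h)"
      using h cell_const_nonneg by (intro mult_right_mono) auto
    then show ?thesis by (simp add: power2_eq_square algebra_simps)
  qed
  finally show ?thesis by (simp add: total_const_def algebra_simps)
qed

lemma abs_refl_le:
  assumes "j < n"
  shows "\<bar>cell_refl j\<bar> \<le> B / (2 * c) * mesh x0 x1 n"
proof -
  have m: "midpoint j \<in> {x0<..<x1}" "midpoint (Suc j) \<in> {x0<..<x1}"
    using assms midpoint_mem[of j] midpoint_mem[of "Suc j"] by auto
  have "\<bar>\<zeta> (midpoint j) - \<zeta> (midpoint (Suc j))\<bar> \<le> B * mesh x0 x1 n"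
    using zeta_lipschitz[OF m] mesh_pos[OF interval, of n] by (simp add: node_Suc)
  moreover have S: "2 * c \<le> \<zeta> (midpoint j) + \<zeta> (midpoint (Suc j))"
    using lower[OF m(1)] lower[OF m(2)] by simp
  ultimately have "\<bar>\<zeta> (midpoint j) - \<zeta> (midpoint (Suc j))\<bar> / (\<zeta> (midpoint j) + \<zeta> (midpoint (Suc j)))
      \<le> B * mesh x0 x1 n / (2 * c)"
    using lower_pos by (intro frac_le) auto
  then show ?thesis using S lower_pos by simp
qed

section \<open>Comparison of the singular with the regular exponential\<close>

abbreviation sing_exp :: "real \<Rightarrow> complex" where
  "sing_exp z \<equiv> sing_harm_exp x0 x1 (std_approx x0 x1 \<zeta> n) z \<omega>"

lemma sing_exp_eq:
  assumes "k \<le> n" "node x0 x1 n k < z" "z \<le> node x0 x1 n (Suc k)"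
  shows "sing_exp z = 1 + (\<Sum>j<k. of_real (cell_refl j) * phase (node x0 x1 n (Suc j))
           * cnj (sing_exp (node x0 x1 n (Suc j))))"
  unfolding sing_harm_exp_std_approx[OF interval assms]
  using assms(1) by (intro arg_cong2[where f = "(+)"] refl sum.cong)
    (auto simp: refl_coeff_std_approx_node[OF interval] phase_def)

text \<open>The exact discrete equation for the singular exponential minus the approximate one for
  the regular exponential: the defect is \<open>point_error\<close>, and the remaining sum is
  controlled by \<open>abs_refl_le\<close> since conjugation and phase preserve the modulus.\<close>

lemma error_recursion:
  assumes "k \<le> n" "node x0 x1 n k < z" "z \<le> node x0 x1 n (Suc k)"
  shows "norm (sing_exp z - harm_exp z) \<le> total_const * mesh x0 x1 n +
    (\<Sum>j<k. B / (2 * c) * mesh x0 x1 n *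
       norm (sing_exp (node x0 x1 n (Suc j)) - harm_exp (node x0 x1 n (Suc j))))"
proof -
  let ?p = "\<lambda>j. node x0 x1 n (Suc j)"
  let ?s = "\<Sum>j<k. of_real (cell_refl j) * phase (?p j) * cnj (sing_exp (?p j) - harm_exp (?p j))"
  let ?t = "\<Sum>j<k. of_real (cell_refl j) * twist (?p j)"
  have "?s = (\<Sum>j<k. of_real (cell_refl j) * phase (?p j) * cnj (sing_exp (?p j))) - ?t"
    unfolding sum_subtractf[symmetric] twist_def
    by (simp only: complex_cnj_diff right_diff_distrib mult.assoc)
  then have "sing_exp z - harm_exp z = ?s - (harm_exp z - 1 - ?t)"
    unfolding sing_exp_eq[OF assms] by (simp only: algebra_simps)
  then have "norm (sing_exp z - harm_exp z) \<le> norm ?s + norm (harm_exp z - 1 - ?t)"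
    by (simp only: norm_triangle_ineq4)
  with point_error[OF assms] have "norm (sing_exp z - harm_exp z) \<le> total_const * mesh x0 x1 n + norm ?s"
    by linarith
  also have "norm ?s \<le> (\<Sum>j<k. B / (2 * c) * mesh x0 x1 n * norm (sing_exp (?p j) - harm_exp (?p j)))"
  proof (rule sum_norm_le)
    fix j assume "j \<in> {..<k}"
    then have "\<bar>cell_refl j\<bar> * norm (sing_exp (?p j) - harm_exp (?p j)) \<le>
        B / (2 * c) * mesh x0 x1 n * norm (sing_exp (?p j) - harm_exp (?p j))"
      using assms(1) by (intro mult_right_mono abs_refl_le) auto
    then show "norm (of_real (cell_refl j) * phase (?p j) * cnj (sing_exp (?p j) - harm_exp (?p j)))
        \<le> B / (2 * c) * mesh x0 x1 n * norm (sing_exp (?p j) - harm_exp (?p j))"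
      by (simp only: norm_mult complex_mod_cnj norm_phase norm_of_real mult_1_right)
  qed
  finally show ?thesis by simp
qed

lemma error_bound:
  assumes "x0 < z" "z \<le> x1"
  shows "norm (sing_exp z - harm_exp z) \<le>
    total_const * exp (B / (2 * c) * (x1 - x0)) * mesh x0 x1 n"
proof -
  let ?\<rho> = "B / (2 * c) * mesh x0 x1 n"
  note h = mesh_pos[OF interval, of n]
  obtain k where k: "k \<le> n" "node x0 x1 n k < z" "z \<le> node x0 x1 n (Suc k)"
    using obtain_cell[OF interval assms] by blast
  \<comment> \<open>The nodes 1 to \<open>k\<close> followed by \<open>z\<close>: thus
    \<open>q i\<close> lies in cell \<open>i\<close> for each \<open>i \<le> k\<close>, and one
    Gronwall recursion covers the nodes and \<open>z\<close> together.\<close>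
  define q where "q i = (if i < k then node x0 x1 n (Suc i) else z)" for i
  define d where "d i = norm (sing_exp (q i) - harm_exp (q i))" for i
  have \<rho>: "?\<rho> \<ge> 0" using h lower_pos slope_pos by simp
  have rec: "d i \<le> total_const * mesh x0 x1 n + (\<Sum>j<i. ?\<rho> * d j)" if "i \<le> k" for i
  proof -
    have "node x0 x1 n i < q i" "q i \<le> node x0 x1 n (Suc i)"
      using that k interval by (auto simp: q_def node_less_iff not_less)
    then have "d i \<le> total_const * mesh x0 x1 n +
        (\<Sum>j<i. ?\<rho> * norm (sing_exp (node x0 x1 n (Suc j)) - harm_exp (node x0 x1 n (Suc j))))"
      unfolding d_def using that k by (intro error_recursion) auto
    also have "(\<Sum>j<i. ?\<rho> * norm (sing_exp (node x0 x1 n (Suc j)) - harm_exp (node x0 x1 n (Suc j)))) =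
        (\<Sum>j<i. ?\<rho> * d j)"
      using that by (intro sum.cong) (auto simp: d_def q_def)
    finally show ?thesis .
  qed
  have "d k \<le> total_const * mesh x0 x1 n * (1 + ?\<rho>) ^ k"
    by (rule discrete_gronwall[OF \<rho> rec]) auto
  also have "\<dots> \<le> total_const * mesh x0 x1 n * exp (B / (2 * c) * (x1 - x0))"
  proof (intro mult_left_mono)
    \<comment> \<open>The Gronwall factor stays bounded: it is at most
      \<open>exp (real k * ?\<rho>)\<close>, and \<open>k\<close> meshes fit into the
      interval.\<close>
    have "(1 + ?\<rho>) ^ k \<le> exp ?\<rho> ^ k"
      using \<rho> by (intro power_mono exp_ge_add_one_self) auto
    also have "\<dots> = exp (real k * ?\<rho>)" by (rule exp_of_nat_mult[symmetric])
    also have "\<dots> \<le> exp (B / (2 * c) * (x1 - x0))"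
    proof -
      have "real k * ?\<rho> \<le> real (Suc n) * ?\<rho>"
        using k(1) \<rho> by (intro mult_right_mono) auto
      also have "\<dots> = B / (2 * c) * (x1 - x0)"
        by (simp only: mult.left_commute[of "real (Suc n)"] Suc_mult_mesh)
      finally show ?thesis by simp
    qed
    finally show "(1 + ?\<rho>) ^ k \<le> exp (B / (2 * c) * (x1 - x0))" .
  qed (use total_const_nonneg h in auto)
  finally show ?thesis by (simp add: d_def q_def mult_ac)
qed

end

text \<open>The simplex for \<open>y \<le> x1\<close> only sees points of the open interval, where
  the cut-off changes nothing.\<close>

lemma reg_harm_exp_eq:
  assumes "y \<le> x1"
  shows "reg_harm_exp x0 (\<lambda>x. - deriv \<zeta> x / (2 * \<zeta> x)) y \<omega> = harm_exp y"
proof -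
  have "reg_harm_term x0 (\<lambda>x. - deriv \<zeta> x / (2 * \<zeta> x)) y \<omega> j = harm_term j y" for j
    unfolding reg_harm_term_def
    unfolding set_lebesgue_integral_def
  proof (intro Bochner_Integration.integral_cong refl)
    fix s
    show "indicator (ordered_simplex x0 y j) s *\<^sub>R
        (exp (2 * \<i> * of_real \<omega> * of_real (\<Sum>\<nu>=1..j. (-1) ^ (j - \<nu>) * (s \<nu> - x0)))
        * of_real (\<Prod>\<nu>=1..j. - deriv \<zeta> (s \<nu>) / (2 * \<zeta> (s \<nu>)))) =
      indicator (ordered_simplex x0 y j) s *\<^sub>R
        (exp (2 * \<i> * of_real \<omega> * of_real (\<Sum>\<nu>=1..j. (-1) ^ (j - \<nu>) * (s \<nu> - x0)))
        * of_real (\<Prod>\<nu>=1..j. coeff (s \<nu>)))"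
    proof (cases "s \<in> ordered_simplex x0 y j")
      case True
      then have "coeff (s \<nu>) = - deriv \<zeta> (s \<nu>) / (2 * \<zeta> (s \<nu>))" if "\<nu> \<in> {1..j}" for \<nu>
        using that assms by (force simp: ordered_simplex_def coeff_def)
      then have "(\<Prod>\<nu>=1..j. coeff (s \<nu>)) = (\<Prod>\<nu>=1..j. - deriv \<zeta> (s \<nu>) / (2 * \<zeta> (s \<nu>)))"
        by (intro prod.cong refl)
      then show ?thesis by (simp only:)
    qed simp
  qed
  then show ?thesis by (simp add: reg_harm_exp_def)
qed

end

theorem lemma2:
  fixes x0 x1 y :: real and \<zeta> :: "real \<Rightarrow> real" and K :: "real set"
  assumes "x0 < x1"
    and "\<zeta> \<in> C1_plus {x0<..<x1}"
    and "y \<in> {x0<..x1}"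
    and "compact K"
  shows "uniform_limit K
           (\<lambda>n \<omega>. sing_harm_exp x0 x1 (std_approx x0 x1 \<zeta> n) y \<omega>)
           (\<lambda>\<omega>. reg_harm_exp x0 (\<lambda>x. - deriv \<zeta> x / (2 * \<zeta> x)) y \<omega>)
           sequentially"
proof -
  let ?X = "{x0<..<x1}"
  from assms(2) obtain c where c: "c > 0" "\<And>x. x \<in> ?X \<Longrightarrow> c \<le> \<zeta> x"
    and C1: "\<zeta> C1_differentiable_on ?X" and reg: "regulated_on ?X (deriv \<zeta>)"
    by (auto simp: C1_plus_def)
  \<comment> \<open>Differentiability of class C1 yields some continuous derivative
    \<open>D\<close>; uniqueness of the derivative identifies it with \<open>deriv \<zeta>\<close>
    on the interval.\<close>
  from C1 obtain D where D: "\<And>x. x \<in> ?X \<Longrightarrow> (\<zeta> has_real_derivative D x) (at x)" "continuous_on ?X D"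
    unfolding C1_differentiable_on_def has_real_derivative_iff_has_vector_derivative by blast
  then have eq: "\<And>x. x \<in> ?X \<Longrightarrow> deriv \<zeta> x = D x" by (blast intro: DERIV_imp_deriv)
  obtain B where B: "B > 0" "\<And>x. x \<in> ?X \<Longrightarrow> \<bar>deriv \<zeta> x\<bar> \<le> B"
    using regulated_on_bounded[OF reg] unfolding bounded_pos by auto
  obtain W where W: "\<And>\<omega>. \<omega> \<in> K \<Longrightarrow> \<bar>\<omega>\<bar> \<le> W"
    using compact_imp_bounded[OF assms(4)] unfolding bounded_pos by auto
  have imp: "impedance x0 x1 \<omega> c B W \<zeta>" if "\<omega> \<in> K" for \<omega>
  proof
    show "continuous_on ?X (deriv \<zeta>)" by (rule continuous_on_eq[OF D(2)]) (simp add: eq)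
    show "(\<zeta> has_real_derivative deriv \<zeta> x) (at x)" if "x \<in> ?X" for x
      using D(1) eq that by simp
  qed (use assms(1) c B W that in auto)
  \<comment> \<open>The constant contains \<open>W\<close> but no \<open>\<omega>\<close>, so one
    rate, linear in the mesh, serves all of \<open>K\<close>.\<close>
  define C where "C = impedance.total_const x0 x1 c B W * exp (B / (2 * c) * (x1 - x0))"
  have bound: "dist (sing_harm_exp x0 x1 (std_approx x0 x1 \<zeta> n) y \<omega>)
      (reg_harm_exp x0 (\<lambda>x. - deriv \<zeta> x / (2 * \<zeta> x)) y \<omega>) \<le> C * mesh x0 x1 n"
    if "\<omega> \<in> K" for n \<omega>
  proof -
    interpret impedance x0 x1 \<omega> c B W \<zeta> by (rule imp[OF that])
    show ?thesis
      using error_bound[of y n] reg_harm_exp_eq[of y] assms(3) by (simp add: C_def dist_norm)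
  qed
  have lim: "(\<lambda>n. C * mesh x0 x1 n) \<longlonglongrightarrow> 0"
    using tendsto_mult_right_zero[OF LIMSEQ_inverse_real_of_nat, of "C * (x1 - x0)"]
    by (simp add: mesh_def divide_inverse mult.assoc add.commute)
  show ?thesis
  proof (rule uniform_limitI)
    fix e :: real assume "e > 0"
    then have "\<forall>\<^sub>F n in sequentially. C * mesh x0 x1 n < e"
      using order_tendstoD(2)[OF lim] by blast
    then show "\<forall>\<^sub>F n in sequentially. \<forall>\<omega>\<in>K. dist (sing_harm_exp x0 x1 (std_approx x0 x1 \<zeta> n) y \<omega>)
      (reg_harm_exp x0 (\<lambda>x. - deriv \<zeta> x / (2 * \<zeta> x)) y \<omega>) < e"
      by eventually_elim (blast intro: order.strict_trans1[OF bound])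
  qed
qed

end
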